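(* $$\lambda(\mathcal{C}_n)\sim\frac{1}{\log_2 n}\qquad(n\to\infty),$$ where $\lambda$ denotes Lebesgue measure on $[0,1]$ and $\mathcal{C}_n$ is the $n$-th sum-level set for regular continued fractions.
   Context: For positive integers $a_1,a_2,\ldots$, $[a_1,a_2,\ldots]:=\cfrac{1}{a_1+\cfrac{1}{a_2+\cdots}}$ denotes the regular continued fraction with these entries; Lebesgue-almost every $x\in[0,1]$ (every irrational) has a unique such infinite expansion. For $n\in\mathbb{N}=\{1,2,\ldots\}$ the sum-level set is $$\mathcal{C}_n:=\Big\{[a_1,a_2,\ldots]\in[0,1]:\ \sum_{i=1}^{k}a_i=n\ \text{for some }k\in\mathbb{N}\Big\}.$$ $\log_2$ is the logarithm to base $2$, and $b_n\sim c_n$ means $\lim_{n\to\infty}b_n/c_n=1$. *)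

theory Defs
  imports "HOL-Analysis.Analysis" "HOL-Library.Landau_Symbols"
begin

fun cfrac_fin :: "nat list \<Rightarrow> real" where
  "cfrac_fin [] = 0"
| "cfrac_fin (a # as) = 1 / (real a + cfrac_fin as)"

text \<open>
  Entries are indexed from 1, as in \<open>[a\<^sub>1, a\<^sub>2, \<dots>]\<close>; the value \<open>a 0\<close> is irrelevant.
  The infinite continued fraction is the limit of its truncations
  \<open>[a\<^sub>1, \<dots>, a\<^sub>k]\<close>, which exists whenever all entries are positive.
\<close>

definition cfrac :: "(nat \<Rightarrow> nat) \<Rightarrow> real" where
  "cfrac a = lim (\<lambda>k. cfrac_fin (map a [1..<Suc k]))"

definition sum_level_set :: "nat \<Rightarrow> real set" where
  "sum_level_set n =
     {x \<in> {0..1}. \<exists>a. (\<forall>i\<ge>1. a i > 0) \<and> x = cfrac a \<and> (\<exists>k\<ge>1. (\<Sum>i=1..k. a i) = n)}"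

end

theory Submission
  imports Defs "HOL-Real_Asymp.Real_Asymp"
begin

text \<open>
  The Farey map \<open>farey\<close> sends \<open>[a\<^sub>1, a\<^sub>2, \<dots>]\<close> to \<open>[a\<^sub>1 - 1, a\<^sub>2, \<dots>]\<close> if \<open>a\<^sub>1 \<ge> 2\<close> and to
  \<open>[a\<^sub>2, a\<^sub>3, \<dots>]\<close> if \<open>a\<^sub>1 = 1\<close>, so each application lowers every partial sum of entries by one.
  Hence, up to rational points, the sum-level set of index \<open>n + 1\<close> is the set of \<open>x\<close> whose \<open>n\<close>-th
  Farey iterate lies in \<open>A = (1/2, 1]\<close>, the points with first entry 1
  (\<open>sum_level_set_iff_farey_iter\<close>). Its measure is governed by the distribution function
  \<open>farey_cdf n\<close> of the \<open>n\<close>-th iterate of a uniformly distributed point.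

  The map preserves the infinite measure \<open>dx/x\<close>. Let \<open>g\<^sub>n = farey_dens n\<close> be the density of the
  \<open>n\<close>-th iterate with respect to it. The transfer operator is
  \<open>g \<mapsto> (\<lambda>x. G (x / (1 + x)))\<close> with \<open>G a = (1 - a) * g a + a * g (1 - a)\<close>. If \<open>g\<close> is concave,
  increasing and nonnegative, then \<open>G\<close> is concave and symmetric about \<open>1/2\<close>, so it increases on
  \<open>[0, 1/2]\<close> and the new density is again concave and increasing (\<open>concave_incr_farey_dens\<close>).
  Moreover \<open>g\<^bsub>n+1\<^esub> 1 = G (1/2) = g\<^sub>n (1/2)\<close>. So \<open>u\<^sub>n = g\<^sub>n 1\<close> is decreasing and on \<open>A\<close> the
  function \<open>g\<^sub>n\<close> lies between \<open>u\<^bsub>n+1\<^esub>\<close> and \<open>u\<^sub>n\<close>. In particular the measure of the level set of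
  index \<open>n + 1\<close> lies between \<open>u\<^bsub>n+1\<^esub> ln 2\<close> and \<open>u\<^sub>n ln 2\<close>.

  It remains to see that \<open>u\<^sub>n\<close> is asymptotic to \<open>1 / ln n\<close>. Splitting the unit interval according
  to the last visit to \<open>A\<close> up to time \<open>n\<close> gives a renewal identity
  (\<open>last_visit_decomposition\<close>), in which a visit at time \<open>j\<close> is weighted by the \<open>dx/x\<close>-measure
  \<open>ln ((m + 2) / (m + 1))\<close> of the points of \<open>A\<close> that do not return within \<open>m = n - j\<close> steps.
  These weights add up to \<open>ln (n + 2)\<close> over \<open>m \<le> n\<close>. By monotonicity of \<open>u\<close> this yields
  \<open>u\<^bsub>n+1\<^esub> ln (n + 2) \<le> 1\<close> at once. For the lower bound on \<open>u\<^sub>k\<close> the identity is used at the time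
  \<open>n = k + k l\<close> with \<open>l\<close> about \<open>ln k\<close>: visits before time \<open>k\<close> then carry total weight at most
  \<open>1/l\<close>, and \<open>ln (n - k + 2)\<close> is still asymptotic to \<open>ln k\<close>.
\<close>

section \<open>Continued fraction expansions\<close>

definition convergent_cf :: "(nat \<Rightarrow> nat) \<Rightarrow> nat \<Rightarrow> real" where
  "convergent_cf a k = cfrac_fin (map a [1..<Suc k])"

lemma convergent_cf_0: "convergent_cf a 0 = 0" by (simp add: convergent_cf_def)

lemma convergent_cf_Suc: "convergent_cf a (Suc k) = 1 / (real (a 1) + convergent_cf (a \<circ> Suc) k)"
proof -
  have "map a [1..<Suc (Suc k)] = a 1 # map (a \<circ> Suc) [1..<Suc k]"
    by (simp add: upt_conv_Cons map_Suc_upt[symmetric] del: upt_Suc)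
  then show ?thesis by (simp add: convergent_cf_def del: upt_Suc)
qed

definition pos_entries :: "(nat \<Rightarrow> nat) \<Rightarrow> bool" where
  "pos_entries a \<longleftrightarrow> (\<forall>i\<ge>1. a i > 0)"

lemma pos_entries_shift: "pos_entries a \<Longrightarrow> pos_entries (a \<circ> Suc)"
  by (auto simp: pos_entries_def)

lemma pos_entries_1: "pos_entries a \<Longrightarrow> real (a 1) \<ge> 1"
  by (simp add: pos_entries_def Suc_leI)

lemma convergent_cf_in_unit: "pos_entries a \<Longrightarrow> convergent_cf a k \<in> {0..1}"
proof (induction k arbitrary: a)
  case (Suc k)
  define c where "c = convergent_cf (a \<circ> Suc) k"
  have "c \<in> {0..1}" unfolding c_def by (rule Suc.IH[OF pos_entries_shift[OF Suc.prems]])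
  then show ?case using pos_entries_1[OF Suc.prems]
    unfolding convergent_cf_Suc c_def[symmetric] by (auto simp: divide_le_eq_1 simp del: One_nat_def)
qed (simp add: convergent_cf_0)

text \<open>
  Since \<open>(m + p) * (m + q) \<ge> 1 + \<bar>p - q\<bar>\<close>, a distance \<open>d\<close> shrinks at least to
  \<open>d / (1 + d)\<close>, and \<open>d \<mapsto> d / (1 + d)\<close> sends \<open>1 / (k + 1)\<close> to \<open>1 / (k + 2)\<close>. The bound is weak,
  but it iterates without grouping entries in pairs.
\<close>

lemma cf_step_contracts:
  fixes m p q :: real
  assumes "m \<ge> 1" "p \<in> {0..1}" "q \<in> {0..1}" "\<bar>p - q\<bar> \<le> 1 / real (Suc k)"
  shows "\<bar>1 / (m + p) - 1 / (m + q)\<bar> \<le> 1 / real (Suc (Suc k))"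
  using assms
proof (induction p q rule: linorder_wlog)
  case (le p q)
  define d where "d = q - p"
  have d: "0 \<le> d" "d * real (Suc k) \<le> 1" using le by (auto simp: d_def field_simps)
  have "1 * (1 + d) \<le> (m + p) * (m + q)"
    using le by (intro mult_mono) (auto simp: d_def)
  then have ge: "1 + d \<le> (m + p) * (m + q)" by simp
  have "1 / (m + p) - 1 / (m + q) = d / ((m + p) * (m + q))"
    using le by (simp add: d_def divide_simps)
  moreover have "0 \<le> d / ((m + p) * (m + q))" using ge d by (intro divide_nonneg_nonneg) auto
  ultimately have "\<bar>1 / (m + p) - 1 / (m + q)\<bar> = d / ((m + p) * (m + q))"
    by (simp only: abs_of_nonneg)
  also have "\<dots> \<le> d / (1 + d)" using ge d by (intro divide_left_mono) auto
  also have "\<dots> \<le> 1 / real (Suc (Suc k))" using d by (simp add: field_simps)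
  finally show ?case .
next
  case (sym p q)
  then show ?case by (simp add: abs_minus_commute)
qed

lemma convergent_cf_close:
  assumes "pos_entries a"
  shows "\<bar>convergent_cf a (k + l) - convergent_cf a (k + m)\<bar> \<le> 1 / real (Suc k)"
  using assms
proof (induction k arbitrary: a)
  case 0
  then show ?case using convergent_cf_in_unit[OF 0, of l] convergent_cf_in_unit[OF 0, of m] by (auto simp: abs_le_iff)
next
  case (Suc k)
  note s = pos_entries_shift[OF Suc.prems]
  show ?case unfolding add_Suc convergent_cf_Suc
    by (rule cf_step_contracts[OF pos_entries_1[OF Suc.prems] convergent_cf_in_unit[OF s]
          convergent_cf_in_unit[OF s] Suc.IH[OF s]])
qed

lemma convergent_cf_tendsto:
  assumes "pos_entries a"
  shows "convergent_cf a \<longlonglongrightarrow> cfrac a"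
proof -
  have "Cauchy (convergent_cf a)"
    unfolding Cauchy_def
  proof (intro allI impI)
    fix e :: real assume "e > 0"
    then obtain k where k: "1 / real (Suc k) < e" using nat_approx_posE by blast
    show "\<exists>M. \<forall>m\<ge>M. \<forall>n\<ge>M. dist (convergent_cf a m) (convergent_cf a n) < e"
    proof (intro exI[of _ k] allI impI)
      fix m n assume "k \<le> m" "k \<le> n"
      then show "dist (convergent_cf a m) (convergent_cf a n) < e"
        using convergent_cf_close[OF assms, of k "m - k" "n - k"] k by (simp add: dist_real_def)
    qed
  qed
  then have "convergent (convergent_cf a)" by (simp add: Cauchy_convergent_iff)
  then show ?thesis unfolding cfrac_def convergent_cf_def[abs_def] by (simp add: convergent_LIMSEQ_iff)
qed

lemma cfrac_in_unit: "pos_entries a \<Longrightarrow> cfrac a \<in> {0..1}"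
  by (rule closed_sequentially[OF closed_atLeastAtMost convergent_cf_in_unit convergent_cf_tendsto])

lemma cfrac_rec:
  assumes "pos_entries a"
  shows "cfrac a = 1 / (real (a 1) + cfrac (a \<circ> Suc))"
proof (rule LIMSEQ_unique)
  show "(\<lambda>k. convergent_cf a (Suc k)) \<longlonglongrightarrow> cfrac a"
    using convergent_cf_tendsto[OF assms] by (rule LIMSEQ_Suc)
  have "real (a 1) + cfrac (a \<circ> Suc) \<noteq> 0"
    using pos_entries_1[OF assms] cfrac_in_unit[OF pos_entries_shift[OF assms]] by auto
  then show "(\<lambda>k. convergent_cf a (Suc k)) \<longlonglongrightarrow> 1 / (real (a 1) + cfrac (a \<circ> Suc))"
    unfolding convergent_cf_Suc
    by (intro tendsto_intros convergent_cf_tendsto pos_entries_shift assms)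
qed

lemma cfrac_cong: "(\<And>i. i \<ge> 1 \<Longrightarrow> a i = b i) \<Longrightarrow> cfrac a = cfrac b"
proof -
  assume "\<And>i. i \<ge> 1 \<Longrightarrow> a i = b i"
  then have "map a [1..<Suc k] = map b [1..<Suc k]" for k by (intro map_cong) auto
  then show ?thesis unfolding cfrac_def by (simp only:)
qed

text \<open>
  The rationals are a null set; every irrational point has an infinite
  expansion, and on the irrationals the two branches of the Farey map never meet their common endpoint.
\<close>

definition unit_irrat :: "real set" where
  "unit_irrat = {0<..<1} - \<rat>"

lemma Rats_imp_inverse: "1 / x \<in> \<rat> \<Longrightarrow> x \<in> (\<rat> :: real set)"
  using Rats_inverse[of "1 / x"] by simp

lemma inverse_frac_unit_irrat:
  assumes "x \<in> unit_irrat"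
  shows "frac (1 / x) \<in> unit_irrat"
proof -
  have "x \<notin> \<rat>" using assms by (simp add: unit_irrat_def)
  then have "1 / x \<notin> \<rat>" using Rats_imp_inverse by blast
  moreover have "1 / x = frac (1 / x) + of_int \<lfloor>1 / x\<rfloor>" by (simp add: frac_def)
  ultimately have "frac (1 / x) \<notin> \<rat>" by (metis Rats_add Rats_of_int)
  moreover from this have "frac (1 / x) \<noteq> 0" by (metis Rats_0)
  ultimately show ?thesis using frac_lt_1[of "1 / x"] frac_ge_0[of "1 / x"] by (auto simp: unit_irrat_def less_le)
qed

definition cf_digit :: "real \<Rightarrow> nat \<Rightarrow> nat" where
  "cf_digit x i = nat \<lfloor>1 / ((\<lambda>y. frac (1 / y)) ^^ (i - 1)) x\<rfloor>"

lemma cf_digit_shift: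
  assumes "i \<ge> 1"
  shows "cf_digit x (Suc i) = cf_digit (frac (1 / x)) i"
proof -
  obtain j where "i = Suc j" using assms by (cases i) auto
  then show ?thesis by (simp add: cf_digit_def funpow_Suc_right del: funpow.simps(2))
qed

lemma convergent_cf_cong: "(\<And>i. i \<ge> 1 \<Longrightarrow> a i = b i) \<Longrightarrow> convergent_cf a k = convergent_cf b k"
  unfolding convergent_cf_def by (intro arg_cong[of _ _ cfrac_fin] map_cong) auto

lemma first_digit:
  assumes "x \<in> unit_irrat"
  shows "cf_digit x 1 \<ge> 1" "x = 1 / (real (cf_digit x 1) + frac (1 / x))"
proof -
  have "1 / x \<ge> 1" "x > 0" using assms by (auto simp: unit_irrat_def field_simps)
  then have "1 \<le> \<lfloor>1 / x\<rfloor>" by (simp add: le_floor_iff del: divide_le_eq_1_pos le_divide_eq_1_pos)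
  then have f: "1 \<le> nat \<lfloor>1 / x\<rfloor>" "real (nat \<lfloor>1 / x\<rfloor>) = of_int \<lfloor>1 / x\<rfloor>" by linarith+
  then show "cf_digit x 1 \<ge> 1" "x = 1 / (real (cf_digit x 1) + frac (1 / x))"
    using f \<open>x > 0\<close> by (simp_all add: cf_digit_def frac_def)
qed

lemma pos_entries_cf_digit: "x \<in> unit_irrat \<Longrightarrow> pos_entries (cf_digit x)"
proof -
  have "x \<in> unit_irrat \<Longrightarrow> cf_digit x (Suc i) \<ge> 1" for i
  proof (induction i arbitrary: x)
    case (Suc i)
    then show ?case using inverse_frac_unit_irrat by (subst cf_digit_shift) auto
  qed (use first_digit in auto)
  then show "x \<in> unit_irrat \<Longrightarrow> pos_entries (cf_digit x)"
    unfolding pos_entries_def by (metis One_nat_def Suc_le_D less_eq_Suc_le)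
qed

text \<open>
  The convergents and \<open>x\<close> arise from the same \<open>k\<close> contracting steps, started from \<open>0\<close> and from
  the \<open>k\<close>-th Gauss iterate of \<open>x\<close>.
\<close>

lemma cfrac_cf_digit:
  assumes "x \<in> unit_irrat"
  shows "cfrac (cf_digit x) = x"
proof -
  have close: "\<bar>convergent_cf (cf_digit x) k - x\<bar> \<le> 1 / real (Suc k)" if "x \<in> unit_irrat" for k x
    using that
  proof (induction k arbitrary: x)
    case 0
    then show ?case by (auto simp: convergent_cf_0 unit_irrat_def)
  next
    case (Suc k)
    let ?y = "frac (1 / x)"
    have y: "?y \<in> unit_irrat" by (rule inverse_frac_unit_irrat[OF Suc.prems])
    have s: "convergent_cf (cf_digit x \<circ> Suc) k = convergent_cf (cf_digit ?y) k"
      by (rule convergent_cf_cong) (use cf_digit_shift in auto)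
    have "\<bar>1 / (real (cf_digit x 1) + convergent_cf (cf_digit ?y) k) - 1 / (real (cf_digit x 1) + ?y)\<bar>
        \<le> 1 / real (Suc (Suc k))"
      using first_digit(1)[OF Suc.prems] y
      by (intro cf_step_contracts Suc.IH y convergent_cf_in_unit pos_entries_cf_digit) (auto simp: unit_irrat_def)
    then show ?case using first_digit(2)[OF Suc.prems] by (simp add: convergent_cf_Suc s)
  qed
  have "convergent_cf (cf_digit x) \<longlonglongrightarrow> x"
  proof (rule LIM_zero_cancel, rule Lim_null_comparison)
    show "eventually (\<lambda>k. norm (convergent_cf (cf_digit x) k - x) \<le> 1 / real (Suc k)) sequentially"
      using close[OF assms] by (intro always_eventually allI) (simp only: real_norm_def)
    show "(\<lambda>k. 1 / real (Suc k)) \<longlonglongrightarrow> 0" by real_asymp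
  qed
  then show ?thesis using convergent_cf_tendsto[OF pos_entries_cf_digit[OF assms]] LIMSEQ_unique by blast
qed

lemma unit_irrat_neq_half: "x \<in> unit_irrat \<Longrightarrow> x \<noteq> 1/2"
proof
  assume "x \<in> unit_irrat" "x = 1/2"
  moreover have "1/2 \<in> (\<rat> :: real set)" by (intro Rats_divide Rats_1 Rats_number_of)
  ultimately show False by (simp add: unit_irrat_def)
qed

section \<open>Sum-level sets and the Farey map\<close>

definition farey :: "real \<Rightarrow> real" where
  "farey x = (if x \<le> 1/2 then x / (1 - x) else (1 - x) / x)"

lemma farey_in_unit: "x \<in> {0..1} \<Longrightarrow> farey x \<in> {0..1}"
  by (auto simp: farey_def field_simps)

lemma farey_iter_in_unit: "x \<in> {0..1} \<Longrightarrow> (farey ^^ n) x \<in> {0..1}"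
  by (induction n) (use farey_in_unit in auto)

lemma farey_unit_irrat:
  assumes "x \<in> unit_irrat"
  shows "farey x \<in> unit_irrat"
proof -
  have x: "0 < x" "x < 1" "x \<notin> \<rat>" using assms by (auto simp: unit_irrat_def)
  have "x \<noteq> 1/2" by (rule unit_irrat_neq_half[OF assms])
  have "farey x \<notin> \<rat>"
  proof
    assume r: "farey x \<in> \<rat>"
    have "farey x > 0" using x by (auto simp: farey_def)
    then have "x = farey x / (1 + farey x) \<or> x = 1 / (1 + farey x)"
      using x by (auto simp: farey_def field_simps)
    then have "x \<in> \<rat>" using r by (metis Rats_1 Rats_add Rats_divide)
    then show False using x by simp
  qed
  moreover have "farey x > 0" "farey x < 1" using x \<open>x \<noteq> 1/2\<close> by (auto simp: farey_def field_simps)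
  ultimately show ?thesis by (auto simp: unit_irrat_def)
qed

text \<open>
  Separating the first entry turns the condition \<open>k \<ge> 1\<close> into an unrestricted existential, which
  suits the two ways the Farey map acts on an expansion.
\<close>

lemma mem_sum_level_set_iff:
  "x \<in> sum_level_set n \<longleftrightarrow> (\<exists>a. pos_entries a \<and> x = cfrac a \<and> (\<exists>k. a 1 + (\<Sum>i=1..k. a (Suc i)) = n))"
proof -
  have s: "(\<Sum>i=1..Suc k. a i) = a 1 + (\<Sum>i=1..k. a (Suc i))" for a :: "nat \<Rightarrow> nat" and k
    by (subst sum.atLeast_Suc_atMost) (auto simp: sum.shift_bounds_cl_Suc_ivl simp del: sum.cl_ivl_Suc)
  have "(\<exists>k\<ge>1. (\<Sum>i=1..k. a i) = n) \<longleftrightarrow> (\<exists>k. a 1 + (\<Sum>i=1..k. a (Suc i)) = n)" for a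
    unfolding s[symmetric] by (metis One_nat_def Suc_le_D le_add1 plus_1_eq_Suc)
  then show ?thesis using cfrac_in_unit unfolding sum_level_set_def pos_entries_def[symmetric] by auto
qed

lemma sum_level_set_1_iff:
  assumes "x \<in> unit_irrat"
  shows "x \<in> sum_level_set 1 \<longleftrightarrow> x > 1/2"
proof
  assume "x \<in> sum_level_set 1"
  then obtain a k where a: "pos_entries a" "x = cfrac a" "a 1 + (\<Sum>i=1..k. a (Suc i)) = 1"
    unfolding mem_sum_level_set_iff by blast
  then have "a 1 = 1" using pos_entries_1[OF a(1)] by linarith
  then have "x = 1 / (1 + cfrac (a \<circ> Suc))" using cfrac_rec[OF a(1)] a(2) by simp
  moreover have "cfrac (a \<circ> Suc) \<in> {0..1}" by (rule cfrac_in_unit[OF pos_entries_shift[OF a(1)]])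
  ultimately have "x \<ge> 1/2" by (auto intro!: frac_le)
  moreover have "x \<noteq> 1/2" by (rule unit_irrat_neq_half[OF assms])
  ultimately show "x > 1/2" by simp
next
  assume x: "x > 1/2"
  have "cf_digit x 1 = 1"
  proof (rule ccontr)
    assume "cf_digit x 1 \<noteq> 1"
    then have c: "real (cf_digit x 1) + frac (1 / x) \<ge> 2"
      using first_digit(1)[OF assms] frac_ge_0[of "1 / x"] by linarith
    have "x \<le> 1 / 2" by (subst first_digit(2)[OF assms]) (use c in \<open>auto intro!: frac_le\<close>)
    then show False using x by simp
  qed
  then have "cf_digit x 1 + (\<Sum>i=1..0. cf_digit x (Suc i)) = 1" by simp
  then show "x \<in> sum_level_set 1" unfolding mem_sum_level_set_iff
    using cfrac_cf_digit[OF assms] pos_entries_cf_digit[OF assms] by metis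
qed

lemma farey_cfrac:
  assumes "pos_entries a" "cfrac a \<in> unit_irrat"
  shows "a 1 = 1 \<Longrightarrow> farey (cfrac a) = cfrac (a \<circ> Suc)"
    and "a 1 \<ge> 2 \<Longrightarrow> farey (cfrac a) = cfrac (a(1 := a 1 - 1))"
proof -
  let ?y = "cfrac (a \<circ> Suc)"
  have y: "?y \<in> {0..1}" by (rule cfrac_in_unit[OF pos_entries_shift[OF assms(1)]])
  note r = cfrac_rec[OF assms(1)]
  have half: "cfrac a \<noteq> 1/2" by (rule unit_irrat_neq_half[OF assms(2)])
  show "farey (cfrac a) = ?y" if "a 1 = 1"
  proof -
    have c: "cfrac a = 1 / (1 + ?y)" using r that by simp
    then have "cfrac a \<ge> 1/2" using y by (auto intro!: frac_le)
    then have "cfrac a > 1/2" using half by simp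
    then have "farey (cfrac a) = (1 - cfrac a) / cfrac a" by (simp add: farey_def)
    also have "\<dots> = ?y" unfolding c using y by (simp add: field_simps)
    finally show ?thesis .
  qed
  show "farey (cfrac a) = cfrac (a(1 := a 1 - 1))" if a1: "a 1 \<ge> 2"
  proof -
    let ?b = "a(1 := a 1 - 1)"
    have "pos_entries ?b" using assms(1) a1 by (auto simp: pos_entries_def)
    then have b: "cfrac ?b = 1 / (real (a 1) - 1 + cfrac (?b \<circ> Suc))"
      using cfrac_rec[of ?b] a1 by (simp add: of_nat_diff)
    have "cfrac (?b \<circ> Suc) = ?y" by (rule cfrac_cong) auto
    then have b': "cfrac ?b = 1 / (real (a 1) - 1 + ?y)" using b by simp
    have "real (a 1) \<ge> 2" using a1 by simp
    then have "cfrac a \<le> 1/2" unfolding r using y by (auto intro!: frac_le simp del: One_nat_def)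
    then have "farey (cfrac a) = cfrac a / (1 - cfrac a)" by (simp add: farey_def)
    also have "\<dots> = cfrac ?b"
    proof -
      define s where "s = real (a 1) + ?y"
      have "s \<ge> 2" using y \<open>real (a 1) \<ge> 2\<close> by (simp add: s_def)
      moreover have "cfrac a = 1 / s" "cfrac ?b = 1 / (s - 1)"
        using r b' by (simp_all add: s_def algebra_simps)
      moreover have "(1 / s) / (1 - 1 / s) = 1 / (s - 1)" if "s \<ge> 2"
        using that by (simp add: field_simps)
      ultimately show ?thesis by (simp only:)
    qed
    finally show ?thesis .
  qed
qed

text \<open>
  Both directions transport a given expansion: forwards by lowering or deleting its first entry,
  backwards by raising the first entry or prepending a 1, according to the branch containing \<open>x\<close>.
\<close>

lemma sum_level_set_Suc_iff:
  assumes x: "x \<in> unit_irrat" and n: "n \<ge> 1"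
  shows "x \<in> sum_level_set (Suc n) \<longleftrightarrow> farey x \<in> sum_level_set n"
proof
  assume "x \<in> sum_level_set (Suc n)"
  then obtain a k where a: "pos_entries a" "x = cfrac a" "a 1 + (\<Sum>i=1..k. a (Suc i)) = Suc n"
    unfolding mem_sum_level_set_iff by blast
  show "farey x \<in> sum_level_set n"
  proof (cases "a 1 = 1")
    case True
    then have s: "(\<Sum>i=1..k. a (Suc i)) = n" using a(3) by simp
    then obtain j where k: "k = Suc j" using n by (cases k) auto
    have "(a \<circ> Suc) 1 + (\<Sum>i=1..j. (a \<circ> Suc) (Suc i)) = n"
      using s unfolding k
      by (subst (asm) sum.atLeast_Suc_atMost) (auto simp: sum.shift_bounds_cl_Suc_ivl simp del: sum.cl_ivl_Suc)
    then show ?thesis unfolding mem_sum_level_set_iff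
      using farey_cfrac(1)[OF a(1)] True x a(2) pos_entries_shift[OF a(1)] by metis
  next
    case False
    then have a1: "a 1 \<ge> 2" using pos_entries_1[OF a(1)] by linarith
    let ?b = "a(1 := a 1 - 1)"
    have "pos_entries ?b" using a(1) a1 by (auto simp: pos_entries_def)
    moreover have "?b 1 + (\<Sum>i=1..k. ?b (Suc i)) = n" using a(3) a1 by simp
    ultimately show ?thesis unfolding mem_sum_level_set_iff
      using farey_cfrac(2)[OF a(1)] a1 x a(2) by metis
  qed
next
  assume "farey x \<in> sum_level_set n"
  then obtain b k where b: "pos_entries b" "farey x = cfrac b" "b 1 + (\<Sum>i=1..k. b (Suc i)) = n"
    unfolding mem_sum_level_set_iff by blast
  note r = cfrac_rec[OF b(1)]
  let ?y = "cfrac (b \<circ> Suc)"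
  have x01: "0 < x" "x < 1" using x by (auto simp: unit_irrat_def)
  show "x \<in> sum_level_set (Suc n)"
  proof (cases "x \<le> 1/2")
    case True
    let ?a = "b(1 := Suc (b 1))"
    have pa: "pos_entries ?a" using b(1) by (auto simp: pos_entries_def)
    have "?y = cfrac (?a \<circ> Suc)" by (rule cfrac_cong) auto
    then have ca: "cfrac ?a = 1 / (real (b 1) + 1 + ?y)" using cfrac_rec[OF pa] by (simp add: add_ac)
    have pos: "real (b 1) + ?y > 0"
      using pos_entries_1[OF b(1)] cfrac_in_unit[OF pos_entries_shift[OF b(1)]] by auto
    have "x / (1 - x) = 1 / (real (b 1) + ?y)" using True r b(2) by (simp add: farey_def)
    then have "x * (real (b 1) + ?y) = 1 - x" using x01 pos by (simp add: frac_eq_eq)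
    then have "x * (real (b 1) + 1 + ?y) = 1" by (simp add: algebra_simps)
    then have "x = cfrac ?a" unfolding ca using pos by (simp add: eq_divide_eq)
    moreover have "?a 1 + (\<Sum>i=1..k. ?a (Suc i)) = Suc n" using b(3) by simp
    ultimately show ?thesis unfolding mem_sum_level_set_iff using pa by blast
  next
    case False
    let ?a = "\<lambda>i. if i \<le> 1 then 1 else b (i - 1)"
    have pa: "pos_entries ?a" using b(1) by (auto simp: pos_entries_def)
    have "cfrac (?a \<circ> Suc) = cfrac b" by (rule cfrac_cong) auto
    then have ca: "cfrac ?a = 1 / (1 + cfrac b)" using cfrac_rec[OF pa] by simp
    have "x = cfrac ?a" unfolding ca b(2)[symmetric] using False x01 by (simp add: farey_def field_simps)
    moreover have "(\<Sum>i=1..Suc k. ?a (Suc i)) = n"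
      using b(3) by (subst sum.atLeast_Suc_atMost) (auto simp: sum.shift_bounds_cl_Suc_ivl simp del: sum.cl_ivl_Suc)
    then have "?a 1 + (\<Sum>i=1..Suc k. ?a (Suc i)) = Suc n" by simp
    ultimately show ?thesis unfolding mem_sum_level_set_iff using pa by blast
  qed
qed

lemma sum_level_set_iff_farey_iter:
  assumes "x \<in> unit_irrat"
  shows "x \<in> sum_level_set (Suc n) \<longleftrightarrow> (farey ^^ n) x > 1/2"
  using assms
proof (induction n arbitrary: x)
  case 0
  then show ?case using sum_level_set_1_iff by simp
next
  case (Suc n)
  then show ?case using sum_level_set_Suc_iff[of x "Suc n"] Suc.IH[OF farey_unit_irrat] 
    by (simp add: funpow_Suc_right del: funpow.simps(2))
qed

section \<open>The distribution of the Farey iterates\<close>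

text \<open>
  The recursion reads off the preimage of \<open>[0, t]\<close> under the Farey map, which is
  \<open>[0, t / (1 + t)] \<union> [1 / (1 + t), 1]\<close>; \<open>measure_farey_iter\<close> makes this precise.
\<close>

fun farey_cdf :: "nat \<Rightarrow> real \<Rightarrow> real" where
  "farey_cdf 0 t = t"
| "farey_cdf (Suc n) t = farey_cdf n (t / (1 + t)) + (1 - farey_cdf n (1 / (1 + t)))"

lemma farey_cdf_1: "farey_cdf n 1 = 1"
  by (cases n) auto

lemma farey_le_iff:
  assumes "y \<in> {0..1}" "t \<in> {0..1}"
  shows "farey y \<le> t \<longleftrightarrow> y \<le> t / (1 + t) \<or> 1 / (1 + t) \<le> y"
proof (cases "y \<le> 1/2")
  case True
  have "1/2 \<le> 1 / (1 + t)" using assms by (auto simp: field_simps)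
  moreover have "farey y \<le> t \<longleftrightarrow> y \<le> t / (1 + t)"
    using True assms by (auto simp: farey_def field_simps)
  moreover have "y \<le> t / (1 + t)" if "1 / (1 + t) \<le> y"
  proof -
    have "1 / (1 + t) \<le> 1/2" using that True by linarith
    then have "t = 1" using assms by (auto simp: field_simps)
    then show ?thesis using True by simp
  qed
  ultimately show ?thesis by blast
next
  case False
  have "t / (1 + t) \<le> 1/2" using assms by (auto simp: field_simps)
  moreover have "farey y \<le> t \<longleftrightarrow> 1 / (1 + t) \<le> y"
    using False assms by (auto simp: farey_def field_simps)
  moreover have "\<not> y \<le> t / (1 + t)" using False \<open>t / (1 + t) \<le> 1/2\<close> by linarith
  ultimately show ?thesis by blast
qed

lemma farey_less_iff:
  assumes "y \<in> {0..1}" "t \<in> {0..1}"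
  shows "farey y < t \<longleftrightarrow> y < t / (1 + t) \<or> 1 / (1 + t) < y"
proof (cases "y \<le> 1/2")
  case True
  have "1/2 \<le> 1 / (1 + t)" using assms by (auto simp: field_simps)
  moreover have "farey y < t \<longleftrightarrow> y < t / (1 + t)"
    using True assms by (auto simp: farey_def field_simps)
  moreover have "\<not> 1 / (1 + t) < y" using True \<open>1/2 \<le> 1 / (1 + t)\<close> by linarith
  ultimately show ?thesis by blast
next
  case False
  have "t / (1 + t) \<le> 1/2" using assms by (auto simp: field_simps)
  moreover have "farey y < t \<longleftrightarrow> 1 / (1 + t) < y"
    using False assms by (auto simp: farey_def field_simps)
  moreover have "\<not> y < t / (1 + t)" using False \<open>t / (1 + t) \<le> 1/2\<close> by linarith
  ultimately show ?thesis by blast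
qed

lemma farey_iter_measurable [measurable]: "(farey ^^ n) \<in> borel_measurable borel"
proof (induction n)
  case (Suc n)
  have "farey \<in> borel_measurable borel" unfolding farey_def[abs_def] by measurable
  from measurable_compose[OF Suc.IH this] show ?case by (simp add: o_def)
qed (simp add: id_def)

lemma lmeasurable_unit_Collect:
  assumes "Measurable.pred borel P"
  shows "{x \<in> {0..1::real}. P x} \<in> lmeasurable"
proof -
  have "{x \<in> {0..1::real}. P x} \<in> sets borel" using assms by measurable
  then have "{x \<in> {0..1::real}. P x} \<in> sets lebesgue" by (metis sets_completionI_sets sets_lborel)
  moreover have "bounded {x \<in> {0..1::real}. P x}" by (rule bounded_subset[of "{0..1}"]) auto
  ultimately show ?thesis by (simp add: bounded_set_imp_lmeasurable)
qed

lemma measure_unit_not: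
  assumes "Measurable.pred borel P"
  shows "measure lebesgue {x \<in> {0..1::real}. \<not> P x} = 1 - measure lebesgue {x \<in> {0..1}. P x}"
proof -
  have "{x \<in> {0..1::real}. \<not> P x} = {0..1} - {x \<in> {0..1}. P x}" by auto
  moreover have "measure lebesgue ({0..1} - {x \<in> {0..1}. P x}) =
      measure lebesgue {0..1::real} - measure lebesgue {x \<in> {0..1}. P x}"
    using lmeasurable_unit_Collect[OF assms] by (intro measurable_measure_Diff) auto
  ultimately show ?thesis by (simp only:) simp
qed

text \<open>
  The strict and the non-strict version are proved together, because complementing the upper part
  of the preimage exchanges them. Together they say that the distribution has no atoms.
\<close>

lemma measure_farey_iter:
  assumes "t \<in> {0..1}"
  shows "measure lebesgue {x \<in> {0..1}. (farey ^^ n) x \<le> t} = farey_cdf n t \<and>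
         measure lebesgue {x \<in> {0..1}. (farey ^^ n) x < t} = farey_cdf n t"
  using assms
proof (induction n arbitrary: t)
  case 0
  have "{x \<in> {0..1}. x \<le> t} = {0..t}" "{x \<in> {0..1}. x < t} = {0..<t}" using 0 by auto
  then show ?case using 0 by simp
next
  case (Suc n)
  let ?a = "t / (1 + t)" and ?b = "1 / (1 + t)" and ?T = "farey ^^ n"
  have ab: "?a \<in> {0..1}" "?b \<in> {0..1}" "?a \<le> ?b" using Suc.prems by (auto simp: divide_le_eq_1 intro!: divide_right_mono)
  have meas: "{x \<in> {0..1}. ?T x \<le> c} \<in> lmeasurable" "{x \<in> {0..1}. ?T x < c} \<in> lmeasurable"
    "{x \<in> {0..1}. c \<le> ?T x} \<in> lmeasurable" "{x \<in> {0..1}. c < ?T x} \<in> lmeasurable" for c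
    by (rule lmeasurable_unit_Collect; measurable)+
  have upper: "measure lebesgue {x \<in> {0..1}. ?b \<le> ?T x} = 1 - farey_cdf n ?b"
    "measure lebesgue {x \<in> {0..1}. ?b < ?T x} = 1 - farey_cdf n ?b"
    using measure_unit_not[of "\<lambda>x. ?T x < ?b"] measure_unit_not[of "\<lambda>x. ?T x \<le> ?b"] Suc.IH[OF ab(2)]
    by (simp_all add: not_less not_le)
  have iff: "(farey ^^ Suc n) x \<le> t \<longleftrightarrow> ?T x \<le> ?a \<or> ?b \<le> ?T x"
    "(farey ^^ Suc n) x < t \<longleftrightarrow> ?T x < ?a \<or> ?b < ?T x" if "x \<in> {0..1}" for x
    using farey_le_iff[OF farey_iter_in_unit[OF that, of n] Suc.prems]
      farey_less_iff[OF farey_iter_in_unit[OF that, of n] Suc.prems] by simp_all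
  \<comment> \<open>At \<open>t = 1\<close> the two closed parts of the preimage share the point \<open>1/2\<close>.\<close>
  have le: "measure lebesgue {x \<in> {0..1}. (farey ^^ Suc n) x \<le> t} = farey_cdf (Suc n) t"
  proof (cases "t = 1")
    case True
    have "(farey ^^ Suc n) x \<le> t" if "x \<in> {0..1}" for x
      using farey_iter_in_unit[OF that, of "Suc n"] True by (simp only: atLeastAtMost_iff)
    then have "{x \<in> {0..1}. (farey ^^ Suc n) x \<le> t} = {0..1}" by blast
    then show ?thesis using True by (simp add: farey_cdf_1)
  next
    case False
    then have "?a < ?b" using Suc.prems by (auto intro!: divide_strict_right_mono)
    then have "{x \<in> {0..1}. ?T x \<le> ?a} \<inter> {x \<in> {0..1}. ?b \<le> ?T x} = {}" by auto
    moreover have "{x \<in> {0..1}. (farey ^^ Suc n) x \<le> t} = {x \<in> {0..1}. ?T x \<le> ?a} \<union> {x \<in> {0..1}. ?b \<le> ?T x}"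
      using iff(1) by blast
    ultimately show ?thesis
      using measure_Un2[OF meas(1)[of ?a] meas(3)[of ?b]] upper Suc.IH[OF ab(1)] by (simp add: Diff_triv Int_commute)
  qed
  have "{x \<in> {0..1}. ?T x < ?a} \<inter> {x \<in> {0..1}. ?b < ?T x} = {}" using ab by auto
  moreover have "{x \<in> {0..1}. (farey ^^ Suc n) x < t} = {x \<in> {0..1}. ?T x < ?a} \<union> {x \<in> {0..1}. ?b < ?T x}"
    using iff(2) by blast
  ultimately have "measure lebesgue {x \<in> {0..1}. (farey ^^ Suc n) x < t} = farey_cdf (Suc n) t"
    using measure_Un2[OF meas(2)[of ?a] meas(4)[of ?b]] upper Suc.IH[OF ab(1)] by (simp add: Diff_triv Int_commute)
  with le show ?case by blast
qed

lemma measure_sum_level_set: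
  "measure (lebesgue_on {0..1}) (sum_level_set (Suc n)) = 1 - farey_cdf n (1/2)"
proof -
  let ?S = "{x \<in> {0..1}. \<not> (farey ^^ n) x \<le> 1/2}" and ?C = "sum_level_set (Suc n)"
  have C: "?C \<subseteq> {0..1}" by (auto simp: sum_level_set_def)
  have S: "?S \<in> lmeasurable" by (rule lmeasurable_unit_Collect) measurable
  have "(?S - ?C) \<union> (?C - ?S) \<subseteq> \<rat>"
  proof
    fix x assume x: "x \<in> (?S - ?C) \<union> (?C - ?S)"
    show "x \<in> \<rat>"
    proof (rule ccontr)
      assume "x \<notin> \<rat>"
      moreover from this have "x \<noteq> 0" "x \<noteq> 1" by auto
      ultimately have "x \<in> unit_irrat" using x C by (auto simp: unit_irrat_def)
      then show False using x C sum_level_set_iff_farey_iter[of x n] by auto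
    qed
  qed
  then have neg: "negligible ((?S - ?C) \<union> (?C - ?S))"
    by (meson countable_rat countable_imp_null_set_lborel negligible_iff_null_sets negligible_subset null_sets_completionI)
  have "?C \<in> sets lebesgue" using sets_negligible_symdiff[OF _ neg] S by auto
  then have "measure (lebesgue_on {0..1}) ?C = measure lebesgue ?C"
    using C by (intro measure_restrict_space) auto
  also have "\<dots> = measure lebesgue ?S" by (rule measure_negligible_symdiff[OF S neg])
  also have "\<dots> = 1 - measure lebesgue {x \<in> {0..1}. (farey ^^ n) x \<le> 1/2}"
    by (rule measure_unit_not) measurable
  also have "\<dots> = 1 - farey_cdf n (1/2)" using measure_farey_iter[of "1/2" n] by simp
  finally show ?thesis .
qed

section \<open>The densities of the Farey iterates\<close>

text \<open>
  With respect to \<open>dx/x\<close>, the transfer operator averages \<open>g\<close> over the two preimages \<open>a\<close> and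
  \<open>1 - a\<close> of \<open>x\<close>, where \<open>a = x / (1 + x)\<close>. Written in terms of \<open>a\<close>, the average is symmetric
  under \<open>a \<mapsto> 1 - a\<close>.
\<close>

definition farey_mix :: "(real \<Rightarrow> real) \<Rightarrow> real \<Rightarrow> real" where
  "farey_mix g a = g a * (1 - a) + a * g (1 - a)"

fun farey_dens :: "nat \<Rightarrow> real \<Rightarrow> real" where
  "farey_dens 0 x = x"
| "farey_dens (Suc n) x = farey_mix (farey_dens n) (x / (1 + x))"

lemma farey_cdf_has_derivative:
  assumes "t > 0"
  shows "(farey_cdf n has_real_derivative farey_dens n t / t) (at t)"
  using assms
proof (induction n arbitrary: t)
  case 0
  have "farey_cdf 0 = (\<lambda>t. t)" by (rule ext) simp
  then show ?case using 0 by (auto intro!: derivative_eq_intros)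
next
  case (Suc n)
  let ?a = "t / (1 + t)" and ?b = "1 / (1 + t)"
  have t: "1 + t \<noteq> 0" "t > 0" using Suc.prems by auto
  have eq: "farey_cdf (Suc n) = (\<lambda>t. farey_cdf n (t / (1 + t)) + (1 - farey_cdf n (1 / (1 + t))))"
    by (rule ext) simp
  have da: "((\<lambda>t. t / (1 + t)) has_real_derivative 1 / (1 + t)\<^sup>2) (at t)"
    using t by (auto intro!: derivative_eq_intros simp: power2_eq_square)
  have db: "((\<lambda>t. 1 / (1 + t)) has_real_derivative - (1 / (1 + t)\<^sup>2)) (at t)"
    using t by (auto intro!: derivative_eq_intros simp: power2_eq_square)
  have A: "((\<lambda>t. farey_cdf n (t / (1 + t))) has_real_derivative
          farey_dens n ?a / ?a * (1 / (1 + t)\<^sup>2)) (at t)"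
    using DERIV_chain2[OF Suc.IH da] t by simp
  have B: "((\<lambda>t. farey_cdf n (1 / (1 + t))) has_real_derivative
          farey_dens n ?b / ?b * - (1 / (1 + t)\<^sup>2)) (at t)"
    using DERIV_chain2[OF Suc.IH db] t by simp
  have mix: "1 - ?a = ?b" using t by (simp add: field_simps)
  have val: "farey_dens n ?a / ?a * (1 / (1 + t)\<^sup>2) + (0 - farey_dens n ?b / ?b * - (1 / (1 + t)\<^sup>2))
        = farey_dens (Suc n) t / t"
    unfolding farey_dens.simps farey_mix_def mix using t
    by (simp add: divide_simps power2_eq_square)
  show ?case unfolding eq val[symmetric]
    by (intro DERIV_add DERIV_diff DERIV_const A B)
qed

lemma concave_on_reflect:
  fixes g :: "real \<Rightarrow> real"
  assumes "concave_on {0..1} g"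
  shows "concave_on {0..1} (\<lambda>a. g (1 - a))"
  unfolding concave_on_iff
proof (intro conjI ballI allI impI)
  fix x y u v :: real
  assume h: "x \<in> {0..1}" "y \<in> {0..1}" "0 \<le> u" "0 \<le> v" "u + v = 1"
  have "g (u *\<^sub>R (1 - x) + v *\<^sub>R (1 - y)) \<ge> u * g (1 - x) + v * g (1 - y)"
    using assms h unfolding concave_on_iff by auto
  moreover have "u *\<^sub>R (1 - x) + v *\<^sub>R (1 - y) = 1 - (u *\<^sub>R x + v *\<^sub>R y)"
    using h(5) by (simp add: algebra_simps)
  ultimately show "g (1 - (u *\<^sub>R x + v *\<^sub>R y)) \<ge> u * g (1 - x) + v * g (1 - y)" by simp
qed auto

definition concave_incr :: "(real \<Rightarrow> real) \<Rightarrow> bool" where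
  "concave_incr g \<longleftrightarrow> concave_on {0..1} g \<and> mono_on {0..1} g \<and> (\<forall>x\<in>{0..1}. g x \<ge> 0)"

text \<open>
  Each summand is a product of an increasing and a decreasing nonnegative concave function, and
  such products are concave.
\<close>

lemma farey_mix_concave:
  assumes "concave_incr g"
  shows "concave_on {0..1} (farey_mix g)"
proof -
  have c: "concave_on {0..1} g" and m: "mono_on {0..1} g" and p: "g \<in> {0..1} \<rightarrow> {0..}"
    using assms by (auto simp: concave_incr_def)
  have aff: "concave_on {0..1} (\<lambda>a::real. 1 - a)"
    using concave_on_reflect[of "\<lambda>x. x"] by (simp add: concave_on_ident)
  have "concave_on {0..1} (\<lambda>a. g a * (1 - a))"
    using c aff m p by (intro concave_on_mul) (auto simp: monotone_on_def)
  moreover have "concave_on {0..1} (\<lambda>a. a * g (1 - a))"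
    using concave_on_reflect[OF c] m p
    by (intro concave_on_mul) (auto simp: concave_on_ident monotone_on_def)
  ultimately have "concave_on {0..1} (\<lambda>a. g a * (1 - a) + a * g (1 - a))"
    by (rule concave_on_add)
  then show ?thesis by (simp add: farey_mix_def[abs_def])
qed

text \<open>
  For \<open>a \<le> b \<le> 1/2\<close> the point \<open>b\<close> lies between \<open>a\<close> and \<open>1 - a\<close>, where a symmetric function
  takes equal values; concavity does the rest.
\<close>

lemma farey_mix_mono:
  assumes "concave_incr g"
  shows "mono_on {0..1/2} (farey_mix g)"
proof (rule mono_onI)
  fix a b :: real
  assume ab: "a \<in> {0..1/2}" "b \<in> {0..1/2}" "a \<le> b"
  show "farey_mix g a \<le> farey_mix g b"
  proof (cases "a = 1/2")
    case True
    then have "b = a" using ab by auto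
    then show ?thesis by simp
  next
    case False
    then have d: "1 - 2 * a > 0" using ab by auto
    define v where "v = (b - a) / (1 - 2 * a)"
    have v: "0 \<le> v" "v \<le> 1" using ab d by (auto simp: v_def field_simps)
    have sym: "farey_mix g (1 - a) = farey_mix g a" by (simp add: farey_mix_def)
    have "v * (1 - 2 * a) = b - a" using d by (simp add: v_def)
    then have b: "(1 - v) *\<^sub>R a + v *\<^sub>R (1 - a) = b" by (simp add: algebra_simps)
    have "farey_mix g ((1 - v) *\<^sub>R a + v *\<^sub>R (1 - a)) \<ge> (1 - v) * farey_mix g a + v * farey_mix g (1 - a)"
      using concave_onD[OF farey_mix_concave[OF assms] v] ab by auto
    then show ?thesis unfolding b sym by (simp add: algebra_simps)
  qed
qed

lemma concave_incr_farey_mix: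
  assumes "concave_incr g"
  shows "concave_incr (\<lambda>x. farey_mix g (x / (1 + x)))"
  unfolding concave_incr_def
proof (intro conjI ballI)
  have range: "x / (1 + x) \<in> {0..1/2}" if "x \<in> {0..1}" for x :: real
    using that by (auto simp: field_simps)
  have mono: "x / (1 + x) \<le> y / (1 + y)" if "x \<in> {0..1}" "y \<in> {0..1}" "x \<le> y" for x y :: real
    using that by (auto simp: field_simps)
  note m = mono_onD[OF farey_mix_mono[OF assms]]
  show "mono_on {0..1} (\<lambda>x. farey_mix g (x / (1 + x)))"
    by (intro mono_onI m range mono) auto
  have cv: "convex_on {0..1} (\<lambda>x::real. - x / (1 + x))"
  proof (rule f''_ge0_imp_convex)
    show "((\<lambda>x. - x / (1 + x)) has_real_derivative - 1 / (1 + x)\<^sup>2) (at x)" if "x \<in> {0..1}" for x :: real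
      using that by (auto intro!: derivative_eq_intros simp: power2_eq_square divide_simps)
    show "((\<lambda>x. - 1 / (1 + x)\<^sup>2) has_real_derivative 2 / (1 + x)^3) (at x)" if "x \<in> {0..1}" for x :: real
      using that by (auto intro!: derivative_eq_intros simp: power2_eq_square power3_eq_cube divide_simps)
    show "0 \<le> 2 / (1 + x)^3" if "x \<in> {0..1}" for x :: real using that by auto
  qed auto
  then have cc: "concave_on {0..1} (\<lambda>x::real. x / (1 + x))"
    by (simp add: concave_on_def)
  show "concave_on {0..1} (\<lambda>x. farey_mix g (x / (1 + x)))"
    unfolding concave_on_iff
  proof (intro conjI ballI allI impI)
    fix x y u v :: real
    assume h: "x \<in> {0..1}" "y \<in> {0..1}" "0 \<le> u" "0 \<le> v" "u + v = 1"
    let ?z = "u *\<^sub>R x + v *\<^sub>R y" and ?w = "u *\<^sub>R (x / (1 + x)) + v *\<^sub>R (y / (1 + y))"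
    have z: "?z \<in> {0..1}" using convexD[OF convex_real_interval(5), of x 0 1 y u v] h by simp
    have w: "?w \<in> {0..1/2}" by (rule convexD[OF convex_real_interval(5) range range]) (use h in auto)
    have rx: "x / (1 + x) \<in> {0..1}" and ry: "y / (1 + y) \<in> {0..1}"
      by (rule subsetD[OF _ range[OF h(1)]] subsetD[OF _ range[OF h(2)]], simp)+
    have wz: "?w \<le> ?z / (1 + ?z)" using cc h unfolding concave_on_iff by auto
    have "u * farey_mix g (x / (1 + x)) + v * farey_mix g (y / (1 + y)) \<le> farey_mix g ?w"
      using farey_mix_concave[OF assms] h(3-5) rx ry unfolding concave_on_iff by blast
    also have "\<dots> \<le> farey_mix g (?z / (1 + ?z))"
      by (rule m[OF w range[OF z] wz])
    finally show "u * farey_mix g (x / (1 + x)) + v * farey_mix g (y / (1 + y))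
        \<le> farey_mix g (?z / (1 + ?z))" .
  qed auto
  show "0 \<le> farey_mix g (x / (1 + x))" if "x \<in> {0..1}" for x
  proof -
    define a where "a = x / (1 + x)"
    have "a \<in> {0..1/2}" unfolding a_def by (rule range[OF that])
    then have "a \<in> {0..1}" "1 - a \<in> {0..1}" by auto
    then show ?thesis using assms unfolding a_def[symmetric] farey_mix_def concave_incr_def by auto
  qed
qed

lemma concave_incr_farey_dens: "concave_incr (farey_dens n)"
proof (induction n)
  case 0
  have "farey_dens 0 = (\<lambda>x. x)" by (rule ext) simp
  then show ?case by (auto simp: concave_incr_def concave_on_ident mono_on_def)
next
  case (Suc n)
  have "farey_dens (Suc n) = (\<lambda>x. farey_mix (farey_dens n) (x / (1 + x)))"
    by (rule ext) simp
  then show ?case using concave_incr_farey_mix[OF Suc.IH] by simp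
qed

definition dens_at_1 :: "nat \<Rightarrow> real" where
  "dens_at_1 n = farey_dens n 1"

text \<open>
  The two preimages of \<open>1\<close> coincide at \<open>1/2\<close>. This ties the oscillation of one density on
  \<open>[1/2, 1]\<close> to the decrease from one density to the next at \<open>1\<close>.
\<close>

lemma dens_at_1_Suc: "dens_at_1 (Suc n) = farey_dens n (1/2)"
  by (simp add: dens_at_1_def farey_mix_def)

lemma farey_dens_bounds:
  assumes "x \<in> {1/2..1}"
  shows "dens_at_1 (Suc n) \<le> farey_dens n x" "farey_dens n x \<le> dens_at_1 n"
proof -
  have m: "mono_on {0..1} (farey_dens n)" using concave_incr_farey_dens by (auto simp: concave_incr_def)
  show "dens_at_1 (Suc n) \<le> farey_dens n x" unfolding dens_at_1_Suc
    using assms by (intro mono_onD[OF m]) auto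
  show "farey_dens n x \<le> dens_at_1 n" unfolding dens_at_1_def
    using assms by (intro mono_onD[OF m]) auto
qed

lemma dens_at_1_decseq: "decseq dens_at_1"
  using order_trans[OF farey_dens_bounds[of 1]] by (intro decseq_SucI) auto

lemma dens_at_1_nonneg: "0 \<le> dens_at_1 n"
  using concave_incr_farey_dens[of n] by (auto simp: concave_incr_def dens_at_1_def)

lemma dens_at_1_le_1: "dens_at_1 n \<le> 1"
  using decseqD[OF dens_at_1_decseq, of 0 n] by (simp add: dens_at_1_def)

text \<open>
  On \<open>[a, 1]\<close> the derivative of \<open>farey_cdf n\<close> lies between \<open>dens_at_1 (Suc n) / x\<close> and
  \<open>dens_at_1 n / x\<close>, so comparing with multiples of \<open>ln\<close> replaces integration.
\<close>

lemma farey_cdf_tail_bounds: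
  assumes "a \<in> {1/2..1}"
  shows "dens_at_1 (Suc n) * ln (1 / a) \<le> 1 - farey_cdf n a"
    and "1 - farey_cdf n a \<le> dens_at_1 n * ln (1 / a)"
proof -
  have D: "((\<lambda>x. farey_cdf n x - c * ln x) has_real_derivative (farey_dens n x - c) / x) (at x)"
    if "x > 0" for x c
    using that by (auto intro!: derivative_eq_intros farey_cdf_has_derivative simp: diff_divide_distrib)
  have "farey_cdf n a - dens_at_1 (Suc n) * ln a \<le> farey_cdf n 1 - dens_at_1 (Suc n) * ln 1"
  proof (rule DERIV_nonneg_imp_nondecreasing[where f = "\<lambda>x. farey_cdf n x - dens_at_1 (Suc n) * ln x"])
    fix x assume "a \<le> x" "x \<le> 1"
    then show "\<exists>y. ((\<lambda>x. farey_cdf n x - dens_at_1 (Suc n) * ln x) has_real_derivative y) (at x) \<and> 0 \<le> y"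
      using D[of x "dens_at_1 (Suc n)"] assms farey_dens_bounds(1)[of x n] by fastforce
  qed (use assms in auto)
  then show "dens_at_1 (Suc n) * ln (1 / a) \<le> 1 - farey_cdf n a"
    using assms by (simp add: farey_cdf_1 ln_div)
  have "farey_cdf n a - dens_at_1 n * ln a \<ge> farey_cdf n 1 - dens_at_1 n * ln 1"
  proof (rule DERIV_nonpos_imp_nonincreasing[where f = "\<lambda>x. farey_cdf n x - dens_at_1 n * ln x"])
    fix x assume "a \<le> x" "x \<le> 1"
    then show "\<exists>y. ((\<lambda>x. farey_cdf n x - dens_at_1 n * ln x) has_real_derivative y) (at x) \<and> y \<le> 0"
      using D[of x "dens_at_1 n"] assms farey_dens_bounds(2)[of x n]
      by (intro exI[of _ "(farey_dens n x - dens_at_1 n) / x"]) (auto simp: divide_le_0_iff)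
  qed (use assms in auto)
  then show "1 - farey_cdf n a \<le> dens_at_1 n * ln (1 / a)"
    using assms by (simp add: farey_cdf_1 ln_div)
qed

section \<open>The renewal equation\<close>

text \<open>
  A point that is below \<open>1 / (m + 1)\<close> at time \<open>n\<close> either was below \<open>1 / (m + 2)\<close> one step earlier
  or was in \<open>[(m + 1) / (m + 2), 1]\<close>, from where it jumped close to 0. Following the first
  alternative back in time records the last visit \<open>j\<close> to \<open>[1/2, 1]\<close>.
\<close>

lemma farey_cdf_last_visit:
  "farey_cdf n (1 / real (Suc m)) =
     (\<Sum>j<n. 1 - farey_cdf j (real (n + m - j) / real (Suc (n + m - j)))) + 1 / real (Suc (n + m))"
proof (induction n arbitrary: m)
  case (Suc n)
  have 1: "1 / real (Suc m) / (1 + 1 / real (Suc m)) = 1 / real (Suc (Suc m))"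
    and 2: "1 / (1 + 1 / real (Suc m)) = real (Suc m) / real (Suc (Suc m))"
    by (simp_all add: field_simps)
  show ?case unfolding farey_cdf.simps 1 2 Suc.IH by simp
qed simp

lemma last_visit_decomposition:
  "1 = (\<Sum>j\<le>n. 1 - farey_cdf j (real (Suc (n - j)) / real (Suc (Suc (n - j))))) + 1 / real (n + 2)"
proof -
  have "(\<Sum>j<Suc n. 1 - farey_cdf j (real (Suc n - j) / real (Suc (Suc n - j)))) =
        (\<Sum>j\<le>n. 1 - farey_cdf j (real (Suc (n - j)) / real (Suc (Suc (n - j)))))"
    unfolding lessThan_Suc_atMost by (intro sum.cong refl) (simp add: Suc_diff_le)
  then show ?thesis using farey_cdf_last_visit[of "Suc n" 0] farey_cdf_1[of "Suc n"] by simp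
qed

text \<open>
  The \<open>dx/x\<close>-measure of \<open>[(m + 1) / (m + 2), 1]\<close>: the points of \<open>[1/2, 1]\<close> that do not
  exceed \<open>1/2\<close> for the next \<open>m\<close> steps.
\<close>

definition return_tail :: "nat \<Rightarrow> real" where
  "return_tail m = ln (real (Suc (Suc m)) / real (Suc m))"

lemma return_tail_nonneg: "0 \<le> return_tail m" by (simp add: return_tail_def)

lemma return_tail_le: "return_tail m \<le> 1 / real (Suc m)"
proof -
  have "real (Suc (Suc m)) / real (Suc m) = 1 + 1 / real (Suc m)" by (simp add: field_simps)
  then show ?thesis unfolding return_tail_def using ln_add_one_self_le_self[of "1 / real (Suc m)"] by simp
qed

lemma sum_return_tail: "(\<Sum>m\<le>n. return_tail m) = ln (real (n + 2))"
  by (induction n) (auto simp: return_tail_def ln_div)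

lemma sum_return_tail_rev:
  assumes "k \<le> n"
  shows "(\<Sum>j=k..n. return_tail (n - j)) = ln (real (n - k + 2))"
proof -
  have "(\<Sum>j=k..n. return_tail (n - j)) = (\<Sum>m\<le>n - k. return_tail m)"
    by (rule sum.reindex_bij_witness[of _ "\<lambda>m. n - m" "\<lambda>j. n - j"]) (use assms in auto)
  then show ?thesis by (simp add: sum_return_tail)
qed

lemma renewal_bounds:
  "(\<Sum>j\<le>n. dens_at_1 (Suc j) * return_tail (n - j)) \<le> 1"
  "1 - 1 / real (n + 2) \<le> (\<Sum>j\<le>n. dens_at_1 j * return_tail (n - j))"
proof -
  have rng: "real (Suc m) / real (Suc (Suc m)) \<in> {1/2..1}" for m by (auto simp: field_simps)
  have inv: "ln (1 / (real (Suc m) / real (Suc (Suc m)))) = return_tail m" for m by (simp add: return_tail_def)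
  note b = farey_cdf_tail_bounds[OF rng, unfolded inv]
  have "(\<Sum>j\<le>n. dens_at_1 (Suc j) * return_tail (n - j)) \<le>
      (\<Sum>j\<le>n. 1 - farey_cdf j (real (Suc (n - j)) / real (Suc (Suc (n - j)))))"
    by (intro sum_mono b)
  also have "\<dots> = 1 - 1 / real (n + 2)" using last_visit_decomposition[of n] by simp
  also have "\<dots> \<le> 1" by simp
  finally show "(\<Sum>j\<le>n. dens_at_1 (Suc j) * return_tail (n - j)) \<le> 1" .
  have "1 - 1 / real (n + 2) = (\<Sum>j\<le>n. 1 - farey_cdf j (real (Suc (n - j)) / real (Suc (Suc (n - j)))))"
    using last_visit_decomposition[of n] by simp
  also have "\<dots> \<le> (\<Sum>j\<le>n. dens_at_1 j * return_tail (n - j))" by (intro sum_mono b)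
  finally show "1 - 1 / real (n + 2) \<le> (\<Sum>j\<le>n. dens_at_1 j * return_tail (n - j))" .
qed

lemma dens_at_1_upper: "dens_at_1 (Suc n) * ln (real (n + 2)) \<le> 1"
proof -
  have "dens_at_1 (Suc n) * ln (real (n + 2)) = (\<Sum>j=0..n. dens_at_1 (Suc n) * return_tail (n - j))"
    using sum_return_tail_rev[of 0 n] by (simp flip: sum_distrib_left)
  also have "\<dots> \<le> (\<Sum>j=0..n. dens_at_1 (Suc j) * return_tail (n - j))"
    by (intro sum_mono mult_right_mono return_tail_nonneg decseqD[OF dens_at_1_decseq]) auto
  also have "\<dots> \<le> 1" using renewal_bounds(1)[of n] by (simp add: atMost_atLeast0)
  finally show ?thesis .
qed

text \<open>
  Visits before time \<open>k\<close> are at least \<open>k * l\<close> steps old at time \<open>k + k * l\<close>; each of these \<open>k\<close>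
  terms is at most \<open>1 / (k * l)\<close>. In all other terms the density is at most \<open>dens_at_1 k\<close>.
\<close>

lemma dens_at_1_lower:
  assumes "k \<ge> 1" "l \<ge> 1"
  shows "1 - 1 / real k - 1 / real l \<le> dens_at_1 k * ln (real (k * l + 2))"
proof -
  define n where "n = k + k * l"
  have split: "{..n} = {..<k} \<union> {k..n}" by (auto simp: n_def)
  have "1 - 1 / real k \<le> 1 - 1 / real (n + 2)"
    using assms by (simp add: n_def frac_le)
  also have "\<dots> \<le> (\<Sum>j\<le>n. dens_at_1 j * return_tail (n - j))" by (rule renewal_bounds)
  also have "\<dots> = (\<Sum>j<k. dens_at_1 j * return_tail (n - j)) + (\<Sum>j=k..n. dens_at_1 j * return_tail (n - j))"
    unfolding split by (rule sum.union_disjoint) auto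
  also have "\<dots> \<le> (\<Sum>j<k. 1 * (1 / real (k * l))) + (\<Sum>j=k..n. dens_at_1 k * return_tail (n - j))"
  proof (intro add_mono sum_mono mult_mono dens_at_1_le_1 dens_at_1_nonneg return_tail_nonneg decseqD[OF dens_at_1_decseq])
    fix j assume j: "j \<in> {..<k}"
    have "k * l \<le> Suc (n - j)" "0 < k * l" using assms j unfolding n_def by auto
    then have "1 / real (Suc (n - j)) \<le> 1 / real (k * l)"
      by (intro frac_le of_nat_mono of_nat_0_less_iff[THEN iffD2]) auto
    with return_tail_le[of "n - j"] have "return_tail (n - j) \<le> 1 / real (k * l)" by linarith
    then show "return_tail (n - j) \<le> 1 / real (k * l)" .
  qed auto
  also have "(\<Sum>j<k. 1 * (1 / real (k * l))) = 1 / real l" using assms by simp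
  also have "(\<Sum>j=k..n. dens_at_1 k * return_tail (n - j)) = dens_at_1 k * ln (real (k * l + 2))"
    using sum_return_tail_rev[of k n] by (simp add: n_def flip: sum_distrib_left)
  finally show ?thesis by simp
qed

lemma dens_at_1_asymp: "(\<lambda>n. dens_at_1 n * ln (real n)) \<longlonglongrightarrow> 1"
proof (rule tendsto_sandwich)
  show "eventually (\<lambda>k. (1 - 1 / real k - 1 / ln (real k)) * ln (real k) / ln (real k * (ln (real k) + 1) + 2)
      \<le> dens_at_1 k * ln (real k)) sequentially"
    using eventually_ge_at_top[of 3]
  proof eventually_elim
    case (elim k)
    have "exp 1 < (3::real)" using e_less_272 by simp
    then have lnk: "ln (real k) \<ge> 1" using elim by (subst ln_ge_iff) auto
    \<comment> \<open>\<open>l\<close> must tend to infinity, but slowly enough that \<open>ln (k * l)\<close> is asymptotic to \<open>ln k\<close>.\<close>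
    define l where "l = nat \<lceil>ln (real k)\<rceil>"
    have l: "ln (real k) \<le> real l" "real l \<le> ln (real k) + 1" "l \<ge> 1"
      using lnk unfolding l_def by linarith+
    have "1 - 1 / real k - 1 / ln (real k) \<le> 1 - 1 / real k - 1 / real l"
      using l lnk by (simp add: frac_le)
    also have "\<dots> \<le> dens_at_1 k * ln (real (k * l + 2))" using elim l by (intro dens_at_1_lower) auto
    also have "\<dots> \<le> dens_at_1 k * ln (real k * (ln (real k) + 1) + 2)"
    proof (intro mult_left_mono dens_at_1_nonneg)
      have "real k * real l \<le> real k * (ln (real k) + 1)" using l by (intro mult_left_mono) auto
      then show "ln (real (k * l + 2)) \<le> ln (real k * (ln (real k) + 1) + 2)"
        by (intro ln_mono) (auto intro!: add_pos_nonneg)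
    qed
    finally have *: "1 - 1 / real k - 1 / ln (real k) \<le> dens_at_1 k * ln (real k * (ln (real k) + 1) + 2)" .
    have "real k * (ln (real k) + 1) \<ge> 0" using lnk by simp
    then have pos: "ln (real k * (ln (real k) + 1) + 2) > 0" by (intro ln_gt_zero) linarith
    have "(1 - 1 / real k - 1 / ln (real k)) * ln (real k)
        \<le> dens_at_1 k * ln (real k * (ln (real k) + 1) + 2) * ln (real k)"
      using * lnk by (intro mult_right_mono) auto
    then show ?case using pos by (simp add: divide_le_eq mult_ac)
  qed
  show "eventually (\<lambda>n. dens_at_1 n * ln (real n) \<le> 1) sequentially"
    using eventually_ge_at_top[of 1]
  proof eventually_elim
    case (elim n)
    then obtain m where n: "n = Suc m" by (cases n) auto
    have "dens_at_1 n * ln (real n) \<le> dens_at_1 n * ln (real (m + 2))"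
      unfolding n by (intro mult_left_mono dens_at_1_nonneg) auto
    also have "\<dots> \<le> 1" unfolding n by (rule dens_at_1_upper)
    finally show ?case .
  qed
  show "(\<lambda>k. (1 - 1 / real k - 1 / ln (real k)) * ln (real k) / ln (real k * (ln (real k) + 1) + 2)) \<longlonglongrightarrow> 1"
    by real_asymp
qed auto

section \<open>The asymptotic law\<close>

theorem theorem1p3:
  "(\<lambda>n. measure (lebesgue_on {0..1}) (sum_level_set n)) \<sim>[sequentially] (\<lambda>n. 1 / log 2 (real n))"
proof -
  let ?l = "\<lambda>n. measure (lebesgue_on {0..1}) (sum_level_set n)"
  have bounds: "dens_at_1 (Suc n) * ln 2 \<le> ?l (Suc n)" "?l (Suc n) \<le> dens_at_1 n * ln 2" for n
    using farey_cdf_tail_bounds[of "1/2" n] by (simp_all add: measure_sum_level_set)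
  have "(\<lambda>n. ?l (Suc n) * log 2 (real (Suc n))) \<longlonglongrightarrow> 1"
  proof (rule tendsto_sandwich)
    show "eventually (\<lambda>n. dens_at_1 (Suc n) * ln (real (Suc n)) \<le> ?l (Suc n) * log 2 (real (Suc n))) sequentially"
    proof (intro always_eventually allI)
      fix n
      have "dens_at_1 (Suc n) * ln (real (Suc n)) = dens_at_1 (Suc n) * ln 2 * log 2 (real (Suc n))"
        by (simp add: log_def)
      also have "\<dots> \<le> ?l (Suc n) * log 2 (real (Suc n))" by (intro mult_right_mono bounds) auto
      finally show "dens_at_1 (Suc n) * ln (real (Suc n)) \<le> ?l (Suc n) * log 2 (real (Suc n))" .
    qed
    show "eventually (\<lambda>n. ?l (Suc n) * log 2 (real (Suc n)) \<le> dens_at_1 n * ln (real n) * (ln (real (Suc n)) / ln (real n))) sequentially"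
      using eventually_ge_at_top[of 2]
    proof eventually_elim
      case (elim n)
      have "?l (Suc n) * log 2 (real (Suc n)) \<le> dens_at_1 n * ln 2 * log 2 (real (Suc n))"
        by (intro mult_right_mono bounds) auto
      also have "\<dots> = dens_at_1 n * ln (real n) * (ln (real (Suc n)) / ln (real n))"
        using elim by (simp add: log_def)
      finally show ?case .
    qed
    show "(\<lambda>n. dens_at_1 (Suc n) * ln (real (Suc n))) \<longlonglongrightarrow> 1"
      by (rule LIMSEQ_Suc[OF dens_at_1_asymp])
    have "(\<lambda>n. ln (real (Suc n)) / ln (real n)) \<longlonglongrightarrow> 1" by real_asymp
    from tendsto_mult[OF dens_at_1_asymp this]
    show "(\<lambda>n. dens_at_1 n * ln (real n) * (ln (real (Suc n)) / ln (real n))) \<longlonglongrightarrow> 1" by simp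
  qed
  then have "(\<lambda>n. ?l n * log 2 (real n)) \<longlonglongrightarrow> 1" by (rule LIMSEQ_imp_Suc)
  then have "(\<lambda>n. ?l n / (1 / log 2 (real n))) \<longlonglongrightarrow> 1" by simp
  then show ?thesis by (rule asymp_equivI')
qed

end
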